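(* Let $a,b\in\mathbb{N}$ with $2<a<b$ and $\gcd(a,b)=1$. Then there exist binary cyclic codes $\mathcal{C}$ such that $\operatorname{Aut}(\mathcal{C})\cong\operatorname{Sym}(a)\times\operatorname{Sym}(b)$.
   Context: A binary linear code of length $N$ ($N$ a positive integer) is a linear subspace $\mathcal{C}$ of $\mathbb{F}_2^N$. The symmetric group $\operatorname{Sym}(N)$ acts on $\mathbb{F}_2^N$ by coordinate permutations, and $\operatorname{Aut}(\mathcal{C})\le\operatorname{Sym}(N)$ is the subgroup of all permutations mapping the subspace $\mathcal{C}$ into itself. The code $\mathcal{C}$ is called cyclic if $\operatorname{Aut}(\mathcal{C})$ contains a regular cycle of length $N$ (i.e. an $N$-cycle). *)

theory Defs
  imports
    Complex_Main
    "HOL-Algebra.Sym_Groups"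
    "HOL-Library.Z2"
    "HOL-Library.Function_Algebras"
begin

text \<open>
  The coordinates of a word of length \<open>N\<close> are indexed by \<open>{1..N}\<close>, the set on which
  \<^const>\<open>sym_group\<close> acts.  So \<open>F2_space N\<close>, the functions vanishing outside \<open>{1..N}\<close>,
  is the space of all binary words of length \<open>N\<close>.
\<close>

definition F2_space :: "nat \<Rightarrow> (nat \<Rightarrow> bit) set"
  where "F2_space N = {v. \<forall>i. i \<notin> {1..N} \<longrightarrow> v i = 0}"

definition F2_scale :: "bit \<Rightarrow> (nat \<Rightarrow> bit) \<Rightarrow> (nat \<Rightarrow> bit)"
  where "F2_scale c v = (\<lambda>i. c * v i)"

interpretation F2: vector_space F2_scale
  by unfold_locales (auto simp: F2_scale_def fun_eq_iff algebra_simps)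

definition binary_linear_code :: "nat \<Rightarrow> (nat \<Rightarrow> bit) set \<Rightarrow> bool"
  where "binary_linear_code N C \<longleftrightarrow> N > 0 \<and> C \<subseteq> F2_space N \<and> F2.subspace C"

text \<open>The inverse makes this a left action: the entry at position \<open>i\<close> moves to position \<open>p i\<close>.\<close>

definition permute_coords :: "(nat \<Rightarrow> nat) \<Rightarrow> (nat \<Rightarrow> bit) \<Rightarrow> (nat \<Rightarrow> bit)"
  where "permute_coords p v = v \<circ> inv' p"

definition code_Aut :: "nat \<Rightarrow> (nat \<Rightarrow> bit) set \<Rightarrow> (nat \<Rightarrow> nat) monoid"
  where "code_Aut N C =
    (sym_group N)\<lparr>carrier := {p \<in> carrier (sym_group N). permute_coords p ` C \<subseteq> C}\<rparr>"

definition is_full_cycle :: "nat \<Rightarrow> (nat \<Rightarrow> nat) \<Rightarrow> bool"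
  where "is_full_cycle N p \<longleftrightarrow> (\<exists>cs. cycle cs \<and> set cs = {1..N} \<and> p = cycle_of_list cs)"

definition binary_cyclic_code :: "nat \<Rightarrow> (nat \<Rightarrow> bit) set \<Rightarrow> bool"
  where "binary_cyclic_code N C \<longleftrightarrow>
    binary_linear_code N C \<and> (\<exists>p \<in> carrier (code_Aut N C). is_full_cycle N p)"

lemma permute_coords_in_F2_space:
  assumes "p permutes {1..N}" "v \<in> F2_space N"
  shows "permute_coords p v \<in> F2_space N"
  using assms permutes_not_in[OF permutes_inv[OF assms(1)]]
  by (auto simp: F2_space_def permute_coords_def)

lemma permute_coords_comp:
  assumes "p permutes {1..N}" "q permutes {1..N}"
  shows "permute_coords (p \<circ> q) v = permute_coords p (permute_coords q v)"
  using assms by (simp add: permute_coords_def permutes_inv_o comp_assoc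
      o_inv_distrib[OF permutes_bij permutes_bij])

lemma finite_F2_space: "finite (F2_space N)"
proof -
  have "finite {v. \<forall>i. (i \<in> {1..N} \<longrightarrow> v i \<in> (UNIV :: bit set)) \<and> (i \<notin> {1..N} \<longrightarrow> v i = 0)}"
  proof (rule finite_set_of_finite_funs)
    have "(UNIV :: bit set) = {0, 1}"
      by (auto intro: bit.exhaust)
    then show "finite (UNIV :: bit set)"
      by (metis finite.emptyI finite.insertI)
  qed simp
  then show ?thesis
    by (simp add: F2_space_def)
qed

lemma code_Aut_subgroup:
  assumes "binary_linear_code N C"
  shows "subgroup (carrier (code_Aut N C)) (sym_group N)"
proof -
  interpret group "sym_group N"
    by (rule sym_group_is_group)
  have fin: "finite C"
    using assms finite_F2_space finite_subset by (auto simp: binary_linear_code_def)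
  show ?thesis
  proof (rule subgroupI)
    show "carrier (code_Aut N C) \<subseteq> carrier (sym_group N)"
      by (auto simp: code_Aut_def)
    have "id \<in> carrier (code_Aut N C)"
      by (auto simp: code_Aut_def sym_group_carrier permutes_id permute_coords_def)
    then show "carrier (code_Aut N C) \<noteq> {}"
      by blast
  next
    fix p q assume "p \<in> carrier (code_Aut N C)" "q \<in> carrier (code_Aut N C)"
    then show "p \<otimes>\<^bsub>sym_group N\<^esub> q \<in> carrier (code_Aut N C)"
      using permute_coords_comp[of p N q]
      by (auto simp: code_Aut_def sym_group_carrier sym_group_mult permutes_compose image_subset_iff)
  next
    fix p assume "p \<in> carrier (code_Aut N C)"
    then have p: "p permutes {1..N}" and sub: "permute_coords p ` C \<subseteq> C"
      by (auto simp: code_Aut_def sym_group_carrier)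
    have q: "inv' p permutes {1..N}"
      using p by (rule permutes_inv)
    have inverse: "permute_coords (inv' p) (permute_coords p v) = v" for v
      using permute_coords_comp[OF q p] p by (simp add: permutes_inv_o permute_coords_def)
    have "inj_on (permute_coords p) C"
      by (metis inj_onI inverse)
    then have "permute_coords p ` C = C"
      using fin sub endo_inj_surj by blast
    then have "permute_coords (inv' p) ` C \<subseteq> C"
      using inverse by (metis image_subset_iff imageE)
    moreover have "inv\<^bsub>sym_group N\<^esub> p = inv' p"
      using p by (intro inv_equality)
        (use q in \<open>auto simp: sym_group_carrier sym_group_mult sym_group_one permutes_inv_o\<close>)
    ultimately show "inv\<^bsub>sym_group N\<^esub> p \<in> carrier (code_Aut N C)"
      using q by (simp add: code_Aut_def sym_group_carrier)
  qed
qed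

end

theory Submission
  imports Defs "HOL-Number_Theory.Cong"
begin

text \<open>
  Arrange \<open>N = a * b\<close> coordinates in a grid with \<open>a\<close> rows and \<open>b\<close> columns, and let the code consist
  of the words whose entry in cell \<open>(i, j)\<close> is \<open>x i + y j\<close> for some \<open>x\<close> and \<open>y\<close>.  Identifying
  cells with edges, this is the cut space of the complete bipartite graph \<open>K\<^bsub>a,b\<^esub>\<close>.  Every
  permutation of the rows combined with a permutation of the columns preserves the code, and for
  coprime \<open>a\<close> and \<open>b\<close> the Chinese remainder theorem makes the product of an \<open>a\<close>-cycle on the rows
  and a \<open>b\<close>-cycle on the columns a single cycle of length \<open>N\<close>: with rows and
  columns counted from zero and coordinate \<open>k\<close> placed in row \<open>k mod a\<close> and column \<open>k mod b\<close>, it is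
  the cyclic shift of the coordinates by one.

  There are no other automorphisms.  If \<open>x\<close> is not constant, then the word has a one in every
  column and so at least \<open>b > a\<close> ones; if \<open>x\<close> is constant, then its ones fill entire columns.  Hence
  the words with exactly \<open>a\<close> ones are the columns, and every automorphism permutes the columns
  (\<open>aut_preserves_same_col\<close>).  The image of a row is then a word with exactly one \<open>1\<close> in each
  column.  Two columns of a word are either equal or complementary, and complementary columns
  together have \<open>a > 2\<close> ones, so all columns of that word are equal and the word is again a row
  (\<open>aut_preserves_same_row\<close>).  An automorphism therefore acts on rows and on columns separately.
\<close>

section \<open>Permutations and words\<close>

lemma bit_add_eq_one_iff: "(x :: bit) + y = 1 \<longleftrightarrow> x \<noteq> y"
  by (cases x; cases y) auto

definition ones :: "(nat \<Rightarrow> bit) \<Rightarrow> nat set"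
  where "ones v = {k. v k = 1}"

lemma permute_coords_apply:
  assumes "p permutes A"
  shows "permute_coords p v (p k) = v k"
  using assms by (simp add: permute_coords_def permutes_inverses)

lemma ones_permute_coords:
  assumes "p permutes A"
  shows "ones (permute_coords p v) = p ` ones v"
  using permutes_inverses[OF assms]
  by (auto simp: ones_def permute_coords_def image_iff) metis

text \<open>By compatibility \<open>f \<circ> p\<close> factors through \<open>f\<close>; the factor is surjective on the finite set \<open>B\<close>
  because \<open>f\<close> and \<open>p\<close> are onto, hence bijective.  With \<open>f\<close> the row or the column map, this
  extracts the permutations of rows and columns from an automorphism.\<close>

lemma permutes_descends:
  fixes f :: "nat \<Rightarrow> nat"
  assumes p: "p permutes A" and f: "f ` A = B" and fin: "finite B"
    and compat: "\<And>k k'. k \<in> A \<Longrightarrow> k' \<in> A \<Longrightarrow> f k = f k' \<Longrightarrow> f (p k) = f (p k')"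
  obtains s where "s permutes B" and "\<And>k. k \<in> A \<Longrightarrow> f (p k) = s (f k)"
proof -
  define s where "s i = (if i \<in> B then f (p (inv_into A f i)) else i)" for i
  have s: "f (p k) = s (f k)" if "k \<in> A" for k
  proof -
    have fk: "f k \<in> f ` A" using that by blast
    then have "f k \<in> B" using f by simp
    then show ?thesis
      unfolding s_def
      using compat[OF that inv_into_into[OF fk]] f_inv_into_f[OF fk] by simp
  qed
  have "B = f ` p ` A" using f permutes_image[OF p] by simp
  also have "\<dots> = s ` f ` A" using s by (force simp: image_iff)
  also have "\<dots> = s ` B" using f by simp
  finally have "s ` B = B" by simp
  then have "inj_on s B" using fin by (simp add: eq_card_imp_inj_on)
  with \<open>s ` B = B\<close> have "bij_betw s B B" by (simp add: bij_betw_def)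
  then have "s permutes B" by (rule bij_imp_permutes) (simp add: s_def)
  with s that show thesis by blast
qed

lemma cycle_of_list_upt:
  assumes "k \<in> {1..n}"
  shows "cycle_of_list [1..<Suc n] k = k mod n + 1"
proof -
  let ?cs = "[1..<Suc n]"
  have cs: "?cs ! i = i + 1" if "i < n" for i
    using that by (subst nth_upt) simp_all
  have k: "k - 1 < n" "k - 1 + 1 = k" "1 + (k - 1) = k" "k mod n < n"
    using assms by auto
  have len: "length ?cs = n" by (simp del: upt_Suc)
  have "map (cycle_of_list ?cs) ?cs = rotate 1 ?cs"
    using cyclic_rotation[of ?cs 1] by (simp del: upt_Suc)
  then have "cycle_of_list ?cs (?cs ! (k - 1)) = rotate 1 ?cs ! (k - 1)"
    using nth_map[of "k - 1" ?cs "cycle_of_list ?cs"] k(1) len by metis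
  also have "\<dots> = ?cs ! (k mod n)"
    using nth_rotate[of "k - 1" ?cs 1] k(1,3) len by metis
  finally show ?thesis
    unfolding cs[OF k(1)] cs[OF k(4)] k(2) .
qed

lemma cycle_of_list_upt_permutes: "cycle_of_list [1..<Suc n] permutes {1..n}"
  using cycle_permutes[of "[1..<Suc n]"] by (simp add: atLeastLessThanSuc_atLeastAtMost del: upt_Suc)

section \<open>The code on a grid\<close>

locale grid =
  fixes a b N :: nat and row col :: "nat \<Rightarrow> nat"
  assumes two_less_a: "2 < a" and a_less_b: "a < b"
    and bij_cells: "bij_betw (\<lambda>k. (row k, col k)) {1..N} ({1..a} \<times> {1..b})"
begin

lemma row_col_in:
  assumes "k \<in> {1..N}"
  shows "row k \<in> {1..a}" "col k \<in> {1..b}"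
  using bij_betw_apply[OF bij_cells assms] by simp_all

lemma cell_eqI:
  assumes "k \<in> {1..N}" "k' \<in> {1..N}" "row k = row k'" "col k = col k'"
  shows "k = k'"
  using bij_betw_imp_inj_on[OF bij_cells] assms by (auto dest: inj_onD)

lemma obtain_cell:
  assumes "i \<in> {1..a}" "j \<in> {1..b}"
  obtains k where "k \<in> {1..N}" "row k = i" "col k = j"
proof -
  have "(i, j) \<in> (\<lambda>k. (row k, col k)) ` {1..N}"
    using assms bij_betw_imp_surj_on[OF bij_cells] by simp
  then show thesis using that by auto
qed

lemma row_image: "row ` {1..N} = {1..a}"
proof
  show "{1..a} \<subseteq> row ` {1..N}"
  proof
    fix i assume i: "i \<in> {1..a}"
    obtain k where "k \<in> {1..N}" "row k = i" "col k = 1"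
      by (rule obtain_cell[OF i, of 1]) (use a_less_b in auto)
    then show "i \<in> row ` {1..N}" by blast
  qed
qed (use row_col_in in blast)

lemma col_image: "col ` {1..N} = {1..b}"
proof
  show "{1..b} \<subseteq> col ` {1..N}"
  proof
    fix j assume j: "j \<in> {1..b}"
    obtain k where "k \<in> {1..N}" "row k = 1" "col k = j"
      by (rule obtain_cell[OF _ j, of 1]) (use two_less_a in auto)
    then show "j \<in> col ` {1..N}" by blast
  qed
qed (use row_col_in in blast)

lemma card_columns:
  assumes "T \<subseteq> {1..b}"
  shows "card {k \<in> {1..N}. col k \<in> T} = a * card T"
proof -
  have "(\<lambda>k. (row k, col k)) ` {k \<in> {1..N}. col k \<in> T} = {1..a} \<times> T"
  proof
    show "{1..a} \<times> T \<subseteq> (\<lambda>k. (row k, col k)) ` {k \<in> {1..N}. col k \<in> T}"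
    proof
      fix z assume "z \<in> {1..a} \<times> T"
      then obtain i j where z: "z = (i, j)" "i \<in> {1..a}" "j \<in> T" by blast
      then obtain k where "k \<in> {1..N}" "row k = i" "col k = j"
        using obtain_cell assms by blast
      with z show "z \<in> (\<lambda>k. (row k, col k)) ` {k \<in> {1..N}. col k \<in> T}" by auto
    qed
  qed (use row_col_in in auto)
  then have "bij_betw (\<lambda>k. (row k, col k)) {k \<in> {1..N}. col k \<in> T} ({1..a} \<times> T)"
    by (intro bij_betw_subset[OF bij_cells]) auto
  from bij_betw_same_card[OF this] show ?thesis
    by (simp add: card_cartesian_product)
qed

text \<open>The cut space of the complete bipartite graph between rows and columns: the cell in row \<open>i\<close> and
  column \<open>j\<close> is an edge, and it is cut when \<open>x i\<close> and \<open>y j\<close> differ.\<close>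

definition cut_code :: "(nat \<Rightarrow> bit) set"
  where "cut_code = {v \<in> F2_space N. \<exists>x y. \<forall>k\<in>{1..N}. v k = x (row k) + y (col k)}"

lemma cut_codeI:
  assumes "v \<in> F2_space N" "\<And>k. k \<in> {1..N} \<Longrightarrow> v k = x (row k) + y (col k)"
  shows "v \<in> cut_code"
  using assms unfolding cut_code_def by blast

lemma cut_codeE:
  assumes "v \<in> cut_code"
  obtains x y where "\<And>k. k \<in> {1..N} \<Longrightarrow> v k = x (row k) + y (col k)"
  using assms unfolding cut_code_def by blast

lemma ones_subset:
  assumes "v \<in> cut_code"
  shows "ones v \<subseteq> {1..N}"
  using assms unfolding cut_code_def F2_space_def ones_def by force

lemma N_pos: "N > 0"
proof -
  have "row ` {1..N} \<noteq> {}" using row_image two_less_a by simp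
  then show ?thesis by simp
qed

lemma cut_code_linear: "binary_linear_code N cut_code"
proof -
  have "F2.subspace cut_code"
  proof (rule F2.subspaceI)
    show "0 \<in> cut_code"
      by (rule cut_codeI[where x = "\<lambda>_. 0" and y = "\<lambda>_. 0"]) (auto simp: F2_space_def)
  next
    fix v w assume v: "v \<in> cut_code" and w: "w \<in> cut_code"
    obtain x y where xy: "\<And>k. k \<in> {1..N} \<Longrightarrow> v k = x (row k) + y (col k)"
      using cut_codeE[OF v] by blast
    obtain x' y' where xy': "\<And>k. k \<in> {1..N} \<Longrightarrow> w k = x' (row k) + y' (col k)"
      using cut_codeE[OF w] by blast
    show "v + w \<in> cut_code"
    proof (rule cut_codeI)
      show "v + w \<in> F2_space N"
        using v w by (simp add: cut_code_def F2_space_def)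
      show "(v + w) k = (\<lambda>i. x i + x' i) (row k) + (\<lambda>j. y j + y' j) (col k)"
        if "k \<in> {1..N}" for k
        using xy[OF that] xy'[OF that] by (simp add: ac_simps del: add_bit_eq_xor)
    qed
  next
    fix c v assume v: "v \<in> cut_code"
    obtain x y where xy: "\<And>k. k \<in> {1..N} \<Longrightarrow> v k = x (row k) + y (col k)"
      using cut_codeE[OF v] by blast
    show "F2_scale c v \<in> cut_code"
    proof (rule cut_codeI)
      show "F2_scale c v \<in> F2_space N"
        using v by (simp add: cut_code_def F2_space_def F2_scale_def)
      show "F2_scale c v k = (\<lambda>i. c * x i) (row k) + (\<lambda>j. c * y j) (col k)"
        if "k \<in> {1..N}" for k
        using xy[OF that]
        by (simp add: F2_scale_def distrib_left del: add_bit_eq_xor mult_bit_eq_and)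
    qed
  qed
  then show ?thesis
    using N_pos by (auto simp: binary_linear_code_def cut_code_def)
qed

abbreviation Aut :: "(nat \<Rightarrow> nat) monoid"
  where "Aut \<equiv> code_Aut N cut_code"

lemma Aut_carrier:
  "p \<in> carrier Aut \<longleftrightarrow> p permutes {1..N} \<and> (\<forall>v\<in>cut_code. permute_coords p v \<in> cut_code)"
  by (auto simp: code_Aut_def sym_group_carrier)

lemma row_col_permutation_in_Aut:
  assumes p: "p permutes {1..N}" and s: "s permutes {1..a}" and t: "t permutes {1..b}"
    and row: "\<And>k. k \<in> {1..N} \<Longrightarrow> row (p k) = s (row k)"
    and col: "\<And>k. k \<in> {1..N} \<Longrightarrow> col (p k) = t (col k)"
  shows "p \<in> carrier Aut"
  unfolding Aut_carrier
proof (intro conjI ballI p)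
  fix v assume v: "v \<in> cut_code"
  obtain x y where xy: "\<And>k. k \<in> {1..N} \<Longrightarrow> v k = x (row k) + y (col k)"
    using cut_codeE[OF v] by blast
  show "permute_coords p v \<in> cut_code"
  proof (rule cut_codeI)
    show "permute_coords p v \<in> F2_space N"
      using permute_coords_in_F2_space[OF p] v by (simp add: cut_code_def)
    fix k assume "k \<in> {1..N}"
    then obtain m where m: "m \<in> {1..N}" "k = p m"
      using permutes_image[OF p] by blast
    show "permute_coords p v k = (x \<circ> inv' s) (row k) + (y \<circ> inv' t) (col k)"
      using m xy row col
      by (simp add: permute_coords_apply[OF p] permutes_inverses[OF s] permutes_inverses[OF t]
          del: add_bit_eq_xor)
  qed
qed

section \<open>Automorphisms act on rows and columns\<close>

text \<open>The columns are the lightest nonzero words.  If \<open>x\<close> takes two different values, then each column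
  contains a \<open>1\<close> in one of the two corresponding rows, which gives \<open>b > a\<close> ones.  Otherwise the
  support is a union of columns, each of size \<open>a\<close>.\<close>

lemma ones_card_a_is_column:
  assumes v: "v \<in> cut_code" and card: "card (ones v) = a"
  obtains j where "ones v = {k \<in> {1..N}. col k = j}"
proof -
  obtain x y where xy: "\<And>k. k \<in> {1..N} \<Longrightarrow> v k = x (row k) + y (col k)"
    using cut_codeE[OF v] by blast
  have const: "x i = x i'" if i: "i \<in> {1..a}" "i' \<in> {1..a}" for i i'
  proof (rule ccontr)
    assume ne: "x i \<noteq> x i'"
    have "{1..b} \<subseteq> col ` ones v"
    proof
      fix j assume j: "j \<in> {1..b}"
      obtain k where k: "k \<in> {1..N}" "row k = i" "col k = j" by (rule obtain_cell[OF i(1) j])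
      obtain k' where k': "k' \<in> {1..N}" "row k' = i'" "col k' = j" by (rule obtain_cell[OF i(2) j])
      have "x i \<noteq> y j \<or> x i' \<noteq> y j" using ne by auto
      then have "v k = 1 \<or> v k' = 1"
        unfolding xy[OF k(1)] xy[OF k'(1)] k(2,3) k'(2,3) bit_add_eq_one_iff .
      then have "k \<in> ones v \<or> k' \<in> ones v" by (simp add: ones_def)
      then show "j \<in> col ` ones v"
        unfolding k(3)[symmetric] using k'(3) k(3) by (metis imageI)
    qed
    moreover have "finite (ones v)"
      using ones_subset[OF v] finite_subset by blast
    ultimately have "card {1..b} \<le> card (ones v)"
      using surj_card_le by blast
    then show False using card a_less_b by simp
  qed
  define T where "T = {j \<in> {1..b}. x 1 \<noteq> y j}"
  have "1 \<in> {1..a}" using two_less_a by simp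
  then have "v k = 1 \<longleftrightarrow> col k \<in> T" if "k \<in> {1..N}" for k
    unfolding xy[OF that] bit_add_eq_one_iff T_def
    using const[OF row_col_in(1)[OF that], of 1] row_col_in(2)[OF that] by simp
  then have T: "ones v = {k \<in> {1..N}. col k \<in> T}"
    using ones_subset[OF v] by (auto simp: ones_def)
  moreover have "T \<subseteq> {1..b}" by (auto simp: T_def)
  ultimately have "card T = 1"
    using card card_columns two_less_a by simp
  then obtain j where "T = {j}" by (auto simp: card_1_singleton_iff)
  with T that show thesis by simp
qed

lemma aut_preserves_same_col:
  assumes p: "p \<in> carrier Aut" and k: "k \<in> {1..N}" "k' \<in> {1..N}" and eq: "col k = col k'"
  shows "col (p k) = col (p k')"
proof -
  from p have perm: "p permutes {1..N}" by (simp add: Aut_carrier)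
  define v :: "nat \<Rightarrow> bit" where "v m = (if m \<in> {1..N} \<and> col m = col k then 1 else 0)" for m
  have v: "v \<in> cut_code"
    by (rule cut_codeI[where x = "\<lambda>_. 0" and y = "\<lambda>j. if j = col k then 1 else 0"])
      (auto simp: v_def F2_space_def)
  have ones_v: "ones v = {m \<in> {1..N}. col m \<in> {col k}}"
    by (auto simp: ones_def v_def)
  have "card (p ` ones v) = card (ones v)"
    by (intro card_image permutes_inj_on[OF perm])
  also have "\<dots> = a"
    unfolding ones_v using card_columns[of "{col k}"] row_col_in(2)[OF k(1)] by simp
  finally have "card (ones (permute_coords p v)) = a"
    by (simp add: ones_permute_coords[OF perm])
  moreover have "permute_coords p v \<in> cut_code"
    using p v by (simp add: Aut_carrier)
  ultimately obtain j where "p ` ones v = {m \<in> {1..N}. col m = j}"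
    using ones_card_a_is_column ones_permute_coords[OF perm] by metis
  moreover have "p k \<in> p ` ones v" "p k' \<in> p ` ones v"
    using k eq by (auto simp: ones_v)
  ultimately show ?thesis by simp
qed

text \<open>If \<open>y\<close> took both values, say at \<open>j\<close> and \<open>j'\<close>, then every row would carry a \<open>1\<close> in column \<open>j\<close>
  or in column \<open>j'\<close>; but these columns have only two ones and there are \<open>a > 2\<close> rows.  So \<open>y\<close> is
  constant and all columns carry their \<open>1\<close> in the same row.\<close>

lemma one_per_column_is_row:
  assumes v: "v \<in> cut_code"
    and unique: "\<And>j. j \<in> {1..b} \<Longrightarrow> \<exists>!k. k \<in> ones v \<and> col k = j"
    and k: "k \<in> ones v" "k' \<in> ones v"
  shows "row k = row k'"
proof -
  obtain x y where xy: "\<And>k. k \<in> {1..N} \<Longrightarrow> v k = x (row k) + y (col k)"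
    using cut_codeE[OF v] by blast
  have in_ones: "m \<in> ones v \<longleftrightarrow> x (row m) \<noteq> y (col m)" if "m \<in> {1..N}" for m
    using xy[OF that] bit_add_eq_one_iff by (simp add: ones_def del: add_bit_eq_xor)
  have single: "i = i'"
    if h: "j \<in> {1..b}" "i \<in> {1..a}" "i' \<in> {1..a}" "x i \<noteq> y j" "x i' \<noteq> y j" for i i' j
  proof -
    obtain m where m: "m \<in> {1..N}" "row m = i" "col m = j"
      by (rule obtain_cell[OF h(2,1)])
    obtain m' where m': "m' \<in> {1..N}" "row m' = i'" "col m' = j"
      by (rule obtain_cell[OF h(3,1)])
    have "m \<in> ones v" "m' \<in> ones v"
      using in_ones[OF m(1)] in_ones[OF m'(1)] m m' h by simp_all
    then have "m = m'"
      using unique[OF h(1)] m(3) m'(3) by blast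
    with m m' show ?thesis by simp
  qed
  have const: "y j = y j'" if j: "j \<in> {1..b}" "j' \<in> {1..b}" for j j'
  proof (rule ccontr)
    assume ne: "y j \<noteq> y j'"
    have split: "x i \<noteq> y j \<or> x i \<noteq> y j'" for i using ne by auto
    have in_a: "1 \<in> {1..a}" "2 \<in> {1..a}" "3 \<in> {1..a}" using two_less_a by auto
    \<comment> \<open>pigeonhole: of the first three rows, two have their \<open>1\<close> in the same column\<close>
    consider (12) l where "l \<in> {1..b}" "x 1 \<noteq> y l" "x 2 \<noteq> y l"
      | (23) l where "l \<in> {1..b}" "x 2 \<noteq> y l" "x 3 \<noteq> y l"
      | (13) l where "l \<in> {1..b}" "x 1 \<noteq> y l" "x 3 \<noteq> y l"
      using split[of 1] split[of 2] split[of 3] j by metis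
    then show False
    proof cases
      case 12
      then show ?thesis using single[OF 12(1) in_a(1,2)] by simp
    next
      case 23
      then show ?thesis using single[OF 23(1) in_a(2,3)] by simp
    next
      case 13
      then show ?thesis using single[OF 13(1) in_a(1,3)] by simp
    qed
  qed
  have kN: "k \<in> {1..N}" "k' \<in> {1..N}" using ones_subset[OF v] k by auto
  have "x (row k) \<noteq> y (col k)" "x (row k') \<noteq> y (col k')"
    using in_ones[OF kN(1)] in_ones[OF kN(2)] k by blast+
  moreover have "y (col k) = y (col k')"
    by (intro const row_col_in(2) kN)
  ultimately show ?thesis
    using single[OF row_col_in(2,1)[OF kN(1)] row_col_in(1)[OF kN(2)]] by simp
qed

text \<open>Rows cannot be recognised by their weight as easily as columns, so this builds on the action on
  columns: it makes the image of a row meet each column exactly once.\<close>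

lemma aut_preserves_same_row:
  assumes p: "p \<in> carrier Aut" and k: "k \<in> {1..N}" "k' \<in> {1..N}" and eq: "row k = row k'"
  shows "row (p k) = row (p k')"
proof -
  from p have perm: "p permutes {1..N}" by (simp add: Aut_carrier)
  define v :: "nat \<Rightarrow> bit" where "v m = (if m \<in> {1..N} \<and> row m = row k then 1 else 0)" for m
  have v: "v \<in> cut_code"
    by (rule cut_codeI[where y = "\<lambda>_. 0" and x = "\<lambda>j. if j = row k then 1 else 0"])
      (auto simp: v_def F2_space_def)
  have ones_v: "ones v = {m \<in> {1..N}. row m = row k}"
    by (auto simp: ones_def v_def)
  obtain t where t: "t permutes {1..b}" and pt: "\<And>m. m \<in> {1..N} \<Longrightarrow> col (p m) = t (col m)"
    using permutes_descends[OF perm col_image] aut_preserves_same_col[OF p] by blast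
  have "permute_coords p v \<in> cut_code"
    using p v by (simp add: Aut_carrier)
  moreover have "\<exists>!m. m \<in> ones (permute_coords p v) \<and> col m = j" if "j \<in> {1..b}" for j
  proof -
    have j': "inv' t j \<in> {1..b}" using that permutes_in_image[OF permutes_inv[OF t]] by simp
    obtain m where m: "m \<in> {1..N}" "row m = row k" "col m = inv' t j"
      using obtain_cell[OF row_col_in(1)[OF k(1)] j'] .
    show ?thesis
      unfolding ones_permute_coords[OF perm] ones_v
    proof (rule ex1I[of _ "p m"])
      show "p m \<in> p ` {m \<in> {1..N}. row m = row k} \<and> col (p m) = j"
        using m pt permutes_inverses[OF t] by simp
    next
      fix q assume "q \<in> p ` {m \<in> {1..N}. row m = row k} \<and> col q = j"
      then obtain n where n: "n \<in> {1..N}" "row n = row k" "q = p n" "t (col n) = j"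
        using pt by auto
      then have "col n = inv' t j" using permutes_inverses[OF t] by auto
      then have "n = m" using n(2) m(2,3) by (intro cell_eqI[OF n(1) m(1)]) simp_all
      then show "q = p m" using n(3) by simp
    qed
  qed
  moreover have "p k \<in> ones (permute_coords p v)" "p k' \<in> ones (permute_coords p v)"
    unfolding ones_permute_coords[OF perm] ones_v using k eq by auto
  ultimately show ?thesis
    using one_per_column_is_row by blast
qed

section \<open>The automorphism group\<close>

definition grid_perm :: "(nat \<Rightarrow> nat) \<times> (nat \<Rightarrow> nat) \<Rightarrow> nat \<Rightarrow> nat"
  where "grid_perm st k = (if k \<in> {1..N}
    then inv_into {1..N} (\<lambda>k. (row k, col k)) (fst st (row k), snd st (col k)) else k)"

lemma grid_perm_cell:
  assumes s: "s permutes {1..a}" and t: "t permutes {1..b}" and k: "k \<in> {1..N}"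
  shows "grid_perm (s, t) k \<in> {1..N}"
    and "row (grid_perm (s, t) k) = s (row k)" "col (grid_perm (s, t) k) = t (col k)"
proof -
  let ?f = "\<lambda>k. (row k, col k)"
  have "(s (row k), t (col k)) \<in> {1..a} \<times> {1..b}"
    using row_col_in[OF k] permutes_in_image[OF s] permutes_in_image[OF t] by simp
  then have mem: "(s (row k), t (col k)) \<in> ?f ` {1..N}"
    using bij_betw_imp_surj_on[OF bij_cells] by simp
  have g: "grid_perm (s, t) k = inv_into {1..N} ?f (s (row k), t (col k))"
    using k by (simp add: grid_perm_def)
  show "grid_perm (s, t) k \<in> {1..N}"
    unfolding g by (rule inv_into_into[OF mem])
  show "row (grid_perm (s, t) k) = s (row k)" "col (grid_perm (s, t) k) = t (col k)"
    using f_inv_into_f[OF mem] unfolding g by (simp_all only: prod.inject)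
qed

lemma grid_perm_eqI:
  assumes s: "s permutes {1..a}" and t: "t permutes {1..b}" and p: "p permutes {1..N}"
    and row: "\<And>k. k \<in> {1..N} \<Longrightarrow> row (p k) = s (row k)"
    and col: "\<And>k. k \<in> {1..N} \<Longrightarrow> col (p k) = t (col k)"
  shows "grid_perm (s, t) = p"
proof
  fix k
  show "grid_perm (s, t) k = p k"
  proof (cases "k \<in> {1..N}")
    case True
    then have "p k \<in> {1..N}" using permutes_in_image[OF p] by blast
    from cell_eqI[OF grid_perm_cell(1)[OF s t True] this] show ?thesis
      unfolding grid_perm_cell(2,3)[OF s t True] row[OF True] col[OF True] by blast
  next
    case False
    then show ?thesis
      unfolding grid_perm_def permutes_not_in[OF p False] by (rule if_not_P)
  qed
qed

lemma grid_perm_permutes: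
  assumes s: "s permutes {1..a}" and t: "t permutes {1..b}"
  shows "grid_perm (s, t) permutes {1..N}"
proof (rule bij_imp_permutes)
  have inj: "inj_on (grid_perm (s, t)) {1..N}"
  proof (rule inj_onI)
    fix k k' assume k: "k \<in> {1..N}" "k' \<in> {1..N}" and eq: "grid_perm (s, t) k = grid_perm (s, t) k'"
    have "s (row k) = s (row k')" "t (col k) = t (col k')"
      using grid_perm_cell[OF s t k(1)] grid_perm_cell[OF s t k(2)] eq by metis+
    then show "k = k'"
      using cell_eqI[OF k] injD[OF permutes_inj[OF s]] injD[OF permutes_inj[OF t]] by blast
  qed
  moreover have "grid_perm (s, t) ` {1..N} \<subseteq> {1..N}"
    using grid_perm_cell(1)[OF s t] by blast
  ultimately show "bij_betw (grid_perm (s, t)) {1..N} {1..N}"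
    using endo_inj_surj[OF finite_atLeastAtMost _ inj] inj unfolding bij_betw_def by blast
qed (simp add: grid_perm_def del: atLeastAtMost_iff)

lemma grid_perm_in_Aut:
  assumes "s permutes {1..a}" "t permutes {1..b}"
  shows "grid_perm (s, t) \<in> carrier Aut"
  by (intro row_col_permutation_in_Aut[OF grid_perm_permutes[OF assms] assms] grid_perm_cell(2,3) assms)

lemma grid_perm_surj:
  assumes p: "p \<in> carrier Aut"
  obtains s t where "s permutes {1..a}" "t permutes {1..b}" "grid_perm (s, t) = p"
proof -
  from p have perm: "p permutes {1..N}" by (simp add: Aut_carrier)
  obtain s where s: "s permutes {1..a}" "\<And>k. k \<in> {1..N} \<Longrightarrow> row (p k) = s (row k)"
    using permutes_descends[OF perm row_image] aut_preserves_same_row[OF p] by blast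
  obtain t where t: "t permutes {1..b}" "\<And>k. k \<in> {1..N} \<Longrightarrow> col (p k) = t (col k)"
    using permutes_descends[OF perm col_image] aut_preserves_same_col[OF p] by blast
  have "grid_perm (s, t) = p"
    by (rule grid_perm_eqI[OF s(1) t(1) perm s(2) t(2)])
  then show thesis
    by (rule that[OF s(1) t(1)])
qed

lemma grid_perm_inj:
  assumes s: "s permutes {1..a}" "s' permutes {1..a}" and t: "t permutes {1..b}" "t' permutes {1..b}"
    and eq: "grid_perm (s, t) = grid_perm (s', t')"
  shows "s = s'" "t = t'"
proof -
  have same: "s (row k) = s' (row k)" "t (col k) = t' (col k)" if "k \<in> {1..N}" for k
    using grid_perm_cell[OF s(1) t(1) that] grid_perm_cell[OF s(2) t(2) that] eq by simp_all
  show "s = s'"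
  proof
    fix i show "s i = s' i"
    proof (cases "i \<in> {1..a}")
      case True
      then have "i \<in> row ` {1..N}" using row_image by simp
      then show ?thesis using same by blast
    next
      case False
      then show ?thesis using permutes_not_in s by metis
    qed
  qed
  show "t = t'"
  proof
    fix j show "t j = t' j"
    proof (cases "j \<in> {1..b}")
      case True
      then have "j \<in> col ` {1..N}" using col_image by simp
      then show ?thesis using same by blast
    next
      case False
      then show ?thesis using permutes_not_in t by metis
    qed
  qed
qed

lemma grid_perm_comp:
  assumes s: "s permutes {1..a}" "s' permutes {1..a}" and t: "t permutes {1..b}" "t' permutes {1..b}"
  shows "grid_perm (s \<circ> s', t \<circ> t') = grid_perm (s, t) \<circ> grid_perm (s', t')"
  using grid_perm_cell[OF s(1) t(1)] grid_perm_cell[OF s(2) t(2)]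
  by (intro grid_perm_eqI permutes_compose s t grid_perm_permutes) (simp_all del: atLeastAtMost_iff)

lemma Aut_iso: "Aut \<cong> sym_group a \<times>\<times> sym_group b"
proof -
  have "grid_perm \<in> iso (sym_group a \<times>\<times> sym_group b) Aut"
  proof (rule isoI)
    show "grid_perm \<in> hom (sym_group a \<times>\<times> sym_group b) Aut"
    proof (rule homI)
      fix z w assume "z \<in> carrier (sym_group a \<times>\<times> sym_group b)"
        and "w \<in> carrier (sym_group a \<times>\<times> sym_group b)"
      then show "grid_perm (z \<otimes>\<^bsub>sym_group a \<times>\<times> sym_group b\<^esub> w)
          = grid_perm z \<otimes>\<^bsub>Aut\<^esub> grid_perm w"
        by (auto simp: code_Aut_def sym_group_carrier sym_group_mult grid_perm_comp)
    qed (auto simp: sym_group_carrier grid_perm_in_Aut)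
    show "bij_betw grid_perm (carrier (sym_group a \<times>\<times> sym_group b)) (carrier Aut)"
      unfolding bij_betw_def
    proof
      show "inj_on grid_perm (carrier (sym_group a \<times>\<times> sym_group b))"
      proof (rule inj_onI)
        fix z w assume z: "z \<in> carrier (sym_group a \<times>\<times> sym_group b)"
          and w: "w \<in> carrier (sym_group a \<times>\<times> sym_group b)"
          and eq: "grid_perm z = grid_perm w"
        obtain s t s' t' where st: "z = (s, t)" "w = (s', t')"
          by (cases z; cases w)
        then have "s permutes {1..a}" "s' permutes {1..a}" "t permutes {1..b}" "t' permutes {1..b}"
          using z w by (auto simp: sym_group_carrier)
        from grid_perm_inj[OF this eq[unfolded st]] show "z = w" unfolding st by simp
      qed
      show "grid_perm ` carrier (sym_group a \<times>\<times> sym_group b) = carrier Aut"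
      proof
        show "carrier Aut \<subseteq> grid_perm ` carrier (sym_group a \<times>\<times> sym_group b)"
        proof
          fix p assume "p \<in> carrier Aut"
          then obtain s t where "s permutes {1..a}" "t permutes {1..b}" "grid_perm (s, t) = p"
            by (rule grid_perm_surj)
          then show "p \<in> grid_perm ` carrier (sym_group a \<times>\<times> sym_group b)"
            by (intro image_eqI[of _ _ "(s, t)"]) (simp_all add: sym_group_carrier)
        qed
      qed (auto simp: sym_group_carrier grid_perm_in_Aut)
    qed
  qed
  then have "sym_group a \<times>\<times> sym_group b \<cong> Aut"
    by (rule is_isoI)
  then show ?thesis
    by (rule group.iso_sym[OF DirProd_group[OF sym_group_is_group sym_group_is_group]])
qed

end

section \<open>The cyclic arrangement of the cells\<close>

text \<open>The Chinese remainder theorem; \<open>{1..a * b}\<close> is a complete system of residues in which \<open>a * b\<close>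
  represents zero.\<close>

lemma bij_betw_mod_cells:
  fixes a b :: nat
  assumes "a > 0" "b > 0" "coprime a b"
  shows "bij_betw (\<lambda>k. (k mod a + 1, k mod b + 1)) {1..a * b} ({1..a} \<times> {1..b})"
proof -
  let ?f = "\<lambda>k. (k mod a + 1, k mod b + 1)"
  have inj: "inj_on ?f {1..a * b}"
  proof (rule inj_onI)
    fix k k' assume k: "k \<in> {1..a * b}" "k' \<in> {1..a * b}" and eq: "?f k = ?f k'"
    then have "[k = k'] (mod a * b)"
      using assms by (auto simp: coprime_cong_mult_nat cong_def[of _ _ a] cong_def[of _ _ b])
    then have "k mod (a * b) = k' mod (a * b)" by (simp add: cong_def)
    then show "k = k'"
      using k by (cases "k = a * b"; cases "k' = a * b") auto
  qed
  have "?f ` {1..a * b} = {1..a} \<times> {1..b}"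
  proof (rule card_subset_eq)
    show "?f ` {1..a * b} \<subseteq> {1..a} \<times> {1..b}"
      using assms by (auto simp: Suc_le_eq)
    show "card (?f ` {1..a * b}) = card ({1..a} \<times> {1..b})"
      using card_image[OF inj] by (simp add: card_cartesian_product)
  qed simp
  with inj show ?thesis by (simp add: bij_betw_def)
qed

lemma succ_mod:
  fixes d n k :: nat
  assumes "d dvd n"
  shows "(k mod n + 1) mod d = (k mod d + 1) mod d"
  using assms by (metis mod_add_left_eq mod_mod_cancel)

theorem theorem4:
  fixes a b :: nat
  assumes "2 < a" and "a < b" and "gcd a b = 1"
  shows "\<exists>N C. binary_cyclic_code N C \<and>
           code_Aut N C \<cong> sym_group a \<times>\<times> sym_group b"
proof -
  let ?N = "a * b"
  let ?row = "\<lambda>k. k mod a + 1" and ?col = "\<lambda>k. k mod b + 1"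
  interpret grid a b ?N ?row ?col
  proof
    show "bij_betw (\<lambda>k. (?row k, ?col k)) {1..?N} ({1..a} \<times> {1..b})"
    proof (rule bij_betw_mod_cells)
      show "0 < a" "0 < b" using assms(1,2) by linarith+
      show "coprime a b" using assms(3) by (simp only: coprime_iff_gcd_eq_1)
    qed
  qed (fact assms)+
  let ?shift = "\<lambda>n. cycle_of_list [1..<Suc n]"
  \<comment> \<open>the shift of the coordinates moves each cell one row and one column further, cyclically\<close>
  have "?shift ?N \<in> carrier Aut"
  proof (rule row_col_permutation_in_Aut[where s = "?shift a" and t = "?shift b"])
    fix k assume k: "k \<in> {1..?N}"
    show "?row (?shift ?N k) = ?shift a (?row k)"
      unfolding cycle_of_list_upt[OF k] cycle_of_list_upt[OF row_col_in(1)[OF k]]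
      by (simp only: succ_mod[of a ?N k] dvd_triv_left)
    show "?col (?shift ?N k) = ?shift b (?col k)"
      unfolding cycle_of_list_upt[OF k] cycle_of_list_upt[OF row_col_in(2)[OF k]]
      by (simp only: succ_mod[of b ?N k] dvd_triv_right)
  qed (fact cycle_of_list_upt_permutes)+
  moreover have "is_full_cycle ?N (?shift ?N)"
  proof -
    have "distinct [1..<Suc ?N]" by (rule distinct_upt)
    moreover have "set [1..<Suc ?N] = {1..?N}"
      by (simp only: set_upt atLeastLessThanSuc_atLeastAtMost)
    ultimately show ?thesis unfolding is_full_cycle_def by blast
  qed
  ultimately have "binary_cyclic_code ?N cut_code"
    unfolding binary_cyclic_code_def using cut_code_linear by blast
  with Aut_iso show ?thesis by blast
qed

end
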